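(* Let $[\mathcal{K}]$ be a germ of hedgehog, and let $\mathrm{Aut}([\mathcal{K}]) = \{ g\in\mathrm{Diff}(\mathbb{C},0) : g([\mathcal{K}]) = [\mathcal{K}]\}$. Then the map $\lambda:\mathrm{Aut}([\mathcal{K}])\to\mathbb{C}^*$, $\lambda(g) = g'(0)$, is an injective group homomorphism with image contained in the unit circle $S^1\subset\mathbb{C}^*$. Consequently $\mathrm{Aut}([\mathcal{K}])$ is abelian and each element of $\mathrm{Aut}([\mathcal{K}])$ is uniquely determined by its rotation number.
   Context: $\mathrm{Diff}(\mathbb{C},0)$ is the group of germs at $0$ of holomorphic diffeomorphisms fixing $0$. A germ $f(z)=e^{2\pi i\alpha}z+O(z^2)$ with $\alpha\in\mathbb{R}\setminus\mathbb{Q}$ is linearizable if there is a holomorphic $h(w)=w+O(w^2)$ with $h^{-1}\circ f\circ h=R_\alpha$, $R_\alpha(w)=e^{2\pi i\alpha}w$; otherwise nonlinearizable. A Siegel compact of $f$ is a full, connected, compact $K\subset\mathbb{C}$ with $0\in K$, $K\ne\{0\}$, such that $f,f^{-1}$ extend univalently to a neighbourhood of $K$ and $f(K)=f^{-1}(K)=K$; $\mathcal{K}(f)$ is the family of all Siegel compacta of $f$. For families $\mathcal{K}$ of compacta containing $0$ with members of arbitrarily small diameter, $\mathcal{K}_1\sim\mathcal{K}_2$ if there is $\epsilon>0$ such that every compact of diameter $<\epsilon$ lies in $\mathcal{K}_1$ iff it lies in $\mathcal{K}_2$; classes are called germs of compacta. A germ of hedgehog is a germ $[\mathcal{K}(f)]$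 for some nonlinearizable $f$ with irrational rotation number. A germ $\phi$ acts by $\phi([\mathcal{K}])=[\{\phi(K):K\in\mathcal{K}'\}]$ for a representative $\mathcal{K}'\sim\mathcal{K}$ all of whose members have a neighbourhood on which $\phi$ is defined. The rotation number of $g$ with $|g'(0)|=1$ is the $\theta\in\mathbb{R}/\mathbb{Z}$ with $g'(0)=e^{2\pi i\theta}$. *)

theory Defs
  imports "HOL-Analysis.Analysis"
begin

text \<open>A representative of an element of Diff(C,0): a holomorphic injective map on a
  disc around 0 fixing 0.  Germs are handled through representatives; two
  representatives define the same germ iff they agree on some disc around 0.\<close>
definition diff_rep :: "(complex \<Rightarrow> complex) \<Rightarrow> real \<Rightarrow> bool" where
  "diff_rep g r \<longleftrightarrow> 0 < r \<and> g holomorphic_on ball 0 r \<and> inj_on g (ball 0 r) \<and> g 0 = 0"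

definition is_diff_germ :: "(complex \<Rightarrow> complex) \<Rightarrow> bool" where
  "is_diff_germ g \<longleftrightarrow> (\<exists>r. diff_rep g r)"

definition same_germ :: "(complex \<Rightarrow> complex) \<Rightarrow> (complex \<Rightarrow> complex) \<Rightarrow> bool" where
  "same_germ g h \<longleftrightarrow> (\<exists>r>0. \<forall>z\<in>ball 0 r. g z = h z)"

definition rot :: "real \<Rightarrow> complex \<Rightarrow> complex" where
  "rot \<alpha> w = exp (2 * pi * \<i> * complex_of_real \<alpha>) * w"

text \<open>Linearizability: h^{-1} o f o h = R_alpha near 0, written as f o h = h o R_alpha
  near 0 with h a germ of diffeomorphism tangent to the identity.\<close>
definition linearizable :: "(complex \<Rightarrow> complex) \<Rightarrow> real \<Rightarrow> bool" where
  "linearizable f \<alpha> \<longleftrightarrow> (\<exists>h r. diff_rep h r \<and> deriv h 0 = 1 \<and>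
      (\<forall>w\<in>ball 0 r. f (h w) = h (rot \<alpha> w)))"

text \<open>Siegel compacta.  "Full" = connected complement.  F extends f univalently to a
  neighbourhood of K, G extends f^{-1} (i.e. G o f = id near 0) univalently.\<close>
definition siegel_compact :: "(complex \<Rightarrow> complex) \<Rightarrow> complex set \<Rightarrow> bool" where
  "siegel_compact f K \<longleftrightarrow>
     compact K \<and> connected K \<and> connected (- K) \<and> 0 \<in> K \<and> K \<noteq> {0} \<and>
     (\<exists>U F. open U \<and> K \<subseteq> U \<and> F holomorphic_on U \<and> inj_on F U \<and>
            same_germ F f \<and> F ` K = K) \<and>
     (\<exists>V G. open V \<and> K \<subseteq> V \<and> G holomorphic_on V \<and> inj_on G V \<and>
            (\<exists>r>0. \<forall>z\<in>ball 0 r. G (f z) = z) \<and> G ` K = K)"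

definition siegel_compacta :: "(complex \<Rightarrow> complex) \<Rightarrow> complex set set" where
  "siegel_compacta f = {K. siegel_compact f K}"

definition small_members :: "complex set set \<Rightarrow> bool" where
  "small_members \<K> \<longleftrightarrow> (\<forall>\<epsilon>>0. \<exists>K\<in>\<K>. diameter K < \<epsilon>)"

definition germ_equiv :: "complex set set \<Rightarrow> complex set set \<Rightarrow> bool" where
  "germ_equiv \<K>1 \<K>2 \<longleftrightarrow> small_members \<K>1 \<and> small_members \<K>2 \<and>
     (\<exists>\<epsilon>>0. \<forall>K. compact K \<and> diameter K < \<epsilon> \<longrightarrow> (K \<in> \<K>1 \<longleftrightarrow> K \<in> \<K>2))"

text \<open>g([K]) = [K]: for a representative K' of [K] whose members lie in the domain
  of a representative of g, the image family is again equivalent to K.\<close>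
definition Aut :: "complex set set \<Rightarrow> (complex \<Rightarrow> complex) set" where
  "Aut \<K> = {g. \<exists>r \<K>'. diff_rep g r \<and> germ_equiv \<K>' \<K> \<and> (\<forall>K\<in>\<K>'. K \<subseteq> ball 0 r) \<and>
                     germ_equiv ((\<lambda>K. g ` K) ` \<K>') \<K>}"

end

theory Submission
  imports Defs "HOL-Complex_Analysis.Complex_Analysis"
begin

text \<open>Write f(z) = \<lambda> z + ... and let g preserve the germ of Siegel compacta of f.  The germ
  h = (g f)^{-1} (f g) is tangent to the identity and maps every small Siegel compact K onto itself.
  If h(z) = z + a z^{n+1} + ... with a nonzero, then its conjugates
  f^{-j} h f^j = z + a \<lambda>^{jn} z^{n+1} + ... also preserve K; evaluated at a point p of K of maximal
  modulus, one of finitely many of them strictly increases |p|, which is absurd.  Hence g commutes with f.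
  If |g'(0)| were not 1, the Koenigs coordinate of g or of its inverse would linearize f.
  If g'(0) = 1, comparing the leading coefficients of g and f^{-1} g f gives a = a \<lambda>^n, so g is the identity.\<close>

text \<open>The multipliers of f g and g f agree, which is why h is tangent to the identity; and
  h(K) = K because K and g(K) are both small Siegel compacta, so that f g(K) = g(K) = g f(K).
  Arbitrarily small K are available since \<open>germ_equiv\<close> demands
  \<open>small_members\<close>. To first order, the sign of Re(a p^n) decides whether z + a z^{n+1}
  moves p outwards, and nothing is known about this sign. Conjugation by f^j replaces a by a
  \<lambda>^{jn}, and since \<lambda> is no root of unity some j turns a p^n towards the positive
  axis. The order of choices shapes the argument: the error estimates hold on a disc that depends on
  the conjugates used, K must lie in that disc, and p comes from K. So the number of conjugates has
  to be fixed first and must serve every possible argument of a p^n.\<close>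

section \<open>Germs at 0, and Siegel compacta inside the domain of f\<close>

lemma same_germ_iff_eventually: "same_germ g h \<longleftrightarrow> (\<forall>\<^sub>F z in nhds 0. g z = h z)"
  by (auto simp: same_germ_def eventually_nhds_metric dist_norm)

text \<open>An injective holomorphic map has nonzero derivative, and the inverse function theorem
  gives the converse. This form is local at 0, so composing germs needs no bookkeeping of
  radii.\<close>

lemma is_diff_germ_iff:
  "is_diff_germ g \<longleftrightarrow> g analytic_on {0} \<and> g 0 = 0 \<and> deriv g 0 \<noteq> 0"
proof
  assume "is_diff_germ g"
  then obtain r where "diff_rep g r"
    by (auto simp: is_diff_germ_def)
  then show "g analytic_on {0} \<and> g 0 = 0 \<and> deriv g 0 \<noteq> 0"
    using holomorphic_injective_imp_regular[of g "ball 0 r" 0]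
    by (auto simp: diff_rep_def analytic_at_ball)
next
  assume *: "g analytic_on {0} \<and> g 0 = 0 \<and> deriv g 0 \<noteq> 0"
  then obtain e where "e > 0" "g holomorphic_on ball 0 e" and "deriv g 0 \<noteq> 0" "0 \<in> ball (0::complex) e"
    by (auto simp: analytic_at_ball)
  then obtain r where "r > 0" "ball 0 r \<subseteq> ball (0::complex) e" "inj_on g (ball 0 r)"
    using has_complex_derivative_locally_injective[of g "ball 0 e" 0] open_ball by metis
  then have "diff_rep g r"
    using * \<open>g holomorphic_on ball 0 e\<close> holomorphic_on_subset by (auto simp: diff_rep_def)
  then show "is_diff_germ g"
    by (auto simp: is_diff_germ_def)
qed

lemma diff_rep_mono: "diff_rep g r \<Longrightarrow> 0 < s \<Longrightarrow> s \<le> r \<Longrightarrow> diff_rep g s"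
  unfolding diff_rep_def
  by (meson holomorphic_on_subset inj_on_subset subset_ball)

lemma germ_has_field_derivative:
  "is_diff_germ g \<Longrightarrow> (g has_field_derivative deriv g 0) (at 0)"
  using analytic_on_imp_differentiable_at[of g "{0}" 0]
  by (simp add: DERIV_deriv_iff_field_differentiable is_diff_germ_iff)

lemma germ_filterlim: "is_diff_germ g \<Longrightarrow> filterlim g (nhds 0) (nhds 0)"
  using germ_has_field_derivative[THEN DERIV_isCont, of g] tendsto_at_iff_tendsto_nhds[of g 0]
  by (simp add: isCont_def is_diff_germ_iff)

lemma eventually_germ:
  "is_diff_germ g \<Longrightarrow> \<forall>\<^sub>F z in nhds 0. P z \<Longrightarrow> \<forall>\<^sub>F z in nhds 0. P (g z)"
  using germ_filterlim[of g] by (auto simp: filterlim_iff)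

lemma germ_deriv_comp:
  "is_diff_germ g \<Longrightarrow> is_diff_germ h \<Longrightarrow> deriv (g \<circ> h) 0 = deriv g 0 * deriv h 0"
  using deriv_chain[of h 0 g]
  by (simp add: is_diff_germ_iff analytic_on_imp_differentiable_at[of _ "{0}"])

lemma germ_comp: "is_diff_germ g \<Longrightarrow> is_diff_germ h \<Longrightarrow> is_diff_germ (g \<circ> h)"
  using germ_deriv_comp[of g h] analytic_on_compose[of h "{0}" g]
  by (auto simp: is_diff_germ_iff)

lemma germ_id: "is_diff_germ id"
  by (simp add: is_diff_germ_iff analytic_on_id)

lemma deriv_cong_germ:
  "same_germ g h \<Longrightarrow> deriv g 0 = deriv h 0"
  by (auto simp: same_germ_iff_eventually intro: deriv_cong_ev)

lemma germ_inverse: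
  assumes "is_diff_germ g"
  obtains h where "is_diff_germ h" "deriv h 0 = inverse (deriv g 0)"
    "\<forall>\<^sub>F z in nhds 0. h (g z) = z" "\<forall>\<^sub>F z in nhds 0. g (h z) = z"
proof -
  obtain r where r: "diff_rep g r"
    using assms by (auto simp: is_diff_germ_def)
  then have hol: "g holomorphic_on ball 0 r" and inj: "inj_on g (ball 0 r)" and "r > 0" and g0: "g 0 = 0"
    by (auto simp: diff_rep_def)
  obtain h where h: "h holomorphic_on g ` ball 0 r"
    "\<And>z. z \<in> ball 0 r \<Longrightarrow> deriv g z * deriv h (g z) = 1"
    "\<And>z. z \<in> ball 0 r \<Longrightarrow> h (g z) = z"
    using holomorphic_has_inverse[OF hol open_ball inj] by metis
  have op: "open (g ` ball 0 r)"
    by (rule open_mapping_thm3[OF hol _ inj]) simp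
  have in0: "0 \<in> g ` ball 0 r"
    using g0 \<open>r > 0\<close> by force
  have d: "deriv g 0 * deriv h 0 = 1" and h0: "h 0 = 0"
    using h(2)[of 0] h(3)[of 0] g0 \<open>r > 0\<close> by auto
  have "is_diff_germ h"
    using h(1) op in0 d h0 by (auto simp: is_diff_germ_iff analytic_at)
  moreover have "deriv h 0 = inverse (deriv g 0)"
    using d by (metis inverse_unique)
  moreover have "\<forall>\<^sub>F z in nhds 0. h (g z) = z"
    using eventually_nhds_in_open[of "ball 0 r" 0] \<open>r > 0\<close> h(3) by (auto elim: eventually_mono)
  moreover have "\<forall>\<^sub>F z in nhds 0. g (h z) = z"
    using eventually_nhds_in_open[OF op in0] by eventually_elim (auto simp: h(3))
  ultimately show ?thesis
    using that by blast
qed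

text \<open>The univalent extension in the definition of a Siegel compact agrees with f only near 0.
  As K is connected and contains 0, it lies in one component of \<open>U \<inter> ball 0 r\<close>,
  and the identity theorem there makes the extension equal to f on K.\<close>

lemma siegel_compact_image:
  assumes "diff_rep f r" "siegel_compact f K" "K \<subseteq> ball 0 r"
  shows "f ` K = K"
proof -
  obtain U F where U: "open U" "K \<subseteq> U" "F holomorphic_on U" "same_germ F f" "F ` K = K"
    using assms(2) by (auto simp: siegel_compact_def)
  have K: "connected K" "0 \<in> K"
    using assms(2) by (auto simp: siegel_compact_def)
  obtain s where s: "s > 0" "\<And>z. z \<in> ball 0 s \<Longrightarrow> F z = f z"
    using U(4) by (auto simp: same_germ_def)
  define W where "W = connected_component_set (U \<inter> ball 0 r) 0"
  have W: "open W" "connected W" "W \<subseteq> U" "W \<subseteq> ball 0 r"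
    using connected_component_subset[of "U \<inter> ball 0 r" 0] U(1)
    unfolding W_def by (auto intro: open_connected_component)
  have "K \<subseteq> W"
    unfolding W_def using K U(2) assms(3) by (intro connected_component_maximal) auto
  have "F z = f z" if "z \<in> W" for z
  proof (rule analytic_continuation_open[of "W \<inter> ball 0 s" W F f])
    show "F holomorphic_on W" "f holomorphic_on W"
      using W U(3) assms(1) holomorphic_on_subset by (auto simp: diff_rep_def)
    show "W \<inter> ball 0 s \<noteq> {}"
      using K \<open>K \<subseteq> W\<close> \<open>s > 0\<close> by (auto simp: disjoint_iff intro!: exI[of _ 0])
  qed (use W s that in auto)
  then have "f ` K = F ` K"
    using \<open>K \<subseteq> W\<close> by (intro image_cong) auto
  then show ?thesis
    using U(5) by simp
qed

section \<open>Leading terms of germs tangent to the identity\<close>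

text \<open>On a small disc around a, E minus its linear part has derivative at most e/2, hence is
  Lipschitz with that constant for any two points. Differentiability at a alone would control only
  quotients against the fixed point a, whereas E is later compared at two moving points, h(f(z)) and
  f(z).\<close>

lemma analytic_strict_derivative:
  assumes "E analytic_on {a}" "(u \<longlongrightarrow> a) F" "(v \<longlongrightarrow> a) F" "\<forall>\<^sub>F x in F. u x \<noteq> v x"
  shows "((\<lambda>x. (E (u x) - E (v x)) / (u x - v x)) \<longlongrightarrow> deriv E a) F"
proof (rule tendstoI)
  fix e :: real assume "e > 0"
  obtain r where r: "r > 0" "E holomorphic_on ball a r"
    using assms(1) by (auto simp: analytic_at_ball)
  have "isCont (deriv E) a"
    using r holomorphic_deriv[of E "ball a r"]
    by (metis analytic_at_ball analytic_at_imp_isCont open_ball)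
  then obtain s where s: "s > 0" "\<And>z. dist z a < s \<Longrightarrow> dist (deriv E z) (deriv E a) < e / 2"
    using \<open>e > 0\<close> unfolding continuous_at_eps_delta by (metis half_gt_zero)
  define S where "S = ball a (min r s)"
  have bd: "norm ((E y - deriv E a * y) - (E z - deriv E a * z)) \<le> e / 2 * norm (y - z)"
    if "y \<in> S" "z \<in> S" for y z
  proof (rule field_differentiable_bound[of S _ "\<lambda>w. deriv E w - deriv E a"])
    fix w assume w: "w \<in> S"
    then have "(E has_field_derivative deriv E w) (at w)"
      using r by (intro holomorphic_derivI[of E "ball a r"]) (auto simp: S_def)
    then show "((\<lambda>w. E w - deriv E a * w) has_field_derivative deriv E w - deriv E a) (at w within S)"
      by (auto intro!: derivative_eq_intros intro: has_field_derivative_at_within)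
    show "norm (deriv E w - deriv E a) \<le> e / 2"
      using s(2)[of w] w by (auto simp: S_def dist_norm norm_minus_commute)
  qed (use that in \<open>auto simp: S_def\<close>)
  have "\<forall>\<^sub>F x in F. u x \<in> S" "\<forall>\<^sub>F x in F. v x \<in> S"
    using topological_tendstoD[OF assms(2), of S] topological_tendstoD[OF assms(3), of S] r(1) s(1)
    by (simp_all add: S_def)
  then show "\<forall>\<^sub>F x in F. dist ((E (u x) - E (v x)) / (u x - v x)) (deriv E a) < e"
    using assms(4)
  proof eventually_elim
    case (elim x)
    have "(E (u x) - E (v x)) / (u x - v x) - deriv E a =
      ((E (u x) - deriv E a * u x) - (E (v x) - deriv E a * v x)) / (u x - v x)"
      using elim by (simp add: field_simps)
    then have "dist ((E (u x) - E (v x)) / (u x - v x)) (deriv E a) \<le> e / 2"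
      using bd[OF elim(1,2)] elim(3) by (simp add: dist_norm norm_divide divide_le_eq)
    then show ?case using \<open>e > 0\<close> by simp
  qed
qed

text \<open>A local inverse shows that g(z) = 0 forces z = 0 near 0. This permits substituting g(z)
  into limits taken along \<open>at 0\<close>.\<close>

lemma germ_filterlim_at: "is_diff_germ g \<Longrightarrow> filterlim g (at 0) (at 0)"
proof -
  assume g: "is_diff_germ g"
  then obtain h where "\<forall>\<^sub>F z in nhds 0. h (g z) = z" "is_diff_germ h"
    by (metis germ_inverse)
  then have "\<forall>\<^sub>F z in at 0. g z \<noteq> 0"
    by (auto simp: eventually_at_filter is_diff_germ_iff elim!: eventually_mono)
  moreover have "(g \<longlongrightarrow> 0) (at 0)"
    using germ_filterlim[OF g] by (rule tendsto_mono[rotated]) (simp add: at_within_le_nhds)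
  ultimately show ?thesis
    by (simp add: filterlim_at)
qed

text \<open>With z = E(f(z)) the quotient factors into three: a difference quotient of E, the
  leading quotient of h at f(z), and (f(z)/z)^{n+1}. Their limits are \<lambda>^{-1}, a and
  \<lambda>^{n+1}. The first factor needs h(f(z)) \<noteq> f(z), which is where
  \<open>a \<noteq> 0\<close> enters.\<close>

lemma conj_leading_term:
  fixes h :: "complex \<Rightarrow> complex"
  assumes f: "is_diff_germ f" and E: "is_diff_germ E" "\<forall>\<^sub>F z in nhds 0. E (f z) = z"
    and h: "is_diff_germ h" "((\<lambda>z. (h z - z) / z ^ Suc n) \<longlongrightarrow> a) (at 0)" and "a \<noteq> 0"
  shows "((\<lambda>z. (E (h (f z)) - z) / z ^ Suc n) \<longlongrightarrow> a * deriv f 0 ^ n) (at 0)"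
proof -
  have dE: "deriv E 0 * deriv f 0 = 1"
    using germ_deriv_comp[OF E(1) f] E(2) deriv_cong_germ[of "E \<circ> f" id]
    by (simp add: same_germ_iff_eventually)
  have f0: "filterlim f (at 0) (at 0)" "(f \<longlongrightarrow> 0) (at 0)"
    using germ_filterlim_at[OF f] by (auto simp: filterlim_at)
  have fz: "((\<lambda>z. f z / z) \<longlongrightarrow> deriv f 0) (at 0)"
    using germ_has_field_derivative[OF f] f by (simp add: has_field_derivative_iff is_diff_germ_iff)
  have 1: "((\<lambda>z. (h (f z) - f z) / f z ^ Suc n) \<longlongrightarrow> a) (at 0)"
    by (rule filterlim_compose[OF h(2) f0(1)])
  have "\<forall>\<^sub>F z in at 0. (h (f z) - f z) / f z ^ Suc n \<noteq> 0"
    using tendsto_imp_eventually_ne[OF 1 \<open>a \<noteq> 0\<close>] .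
  then have ne: "\<forall>\<^sub>F z in at 0. h (f z) \<noteq> f z"
    by eventually_elim auto
  have 2: "((\<lambda>z. (E (h (f z)) - E (f z)) / (h (f z) - f z)) \<longlongrightarrow> deriv E 0) (at 0)"
    using E(1) f0 ne filterlim_compose[OF _ f0(1), of h "nhds 0"] germ_filterlim_at[OF h(1)]
    by (intro analytic_strict_derivative) (auto simp: is_diff_germ_iff filterlim_at)
  have "((\<lambda>z. (E (h (f z)) - E (f z)) / (h (f z) - f z) * ((h (f z) - f z) / f z ^ Suc n) * (f z / z) ^ Suc n)
    \<longlongrightarrow> deriv E 0 * a * deriv f 0 ^ Suc n) (at 0)"
    by (intro tendsto_intros 1 2 fz)
  also have "deriv E 0 * a * deriv f 0 ^ Suc n = (deriv E 0 * deriv f 0) * a * deriv f 0 ^ n"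
    by (simp only: power_Suc ac_simps)
  also have "\<dots> = a * deriv f 0 ^ n"
    by (simp only: dE mult_1)
  finally show ?thesis
  proof (rule Lim_transform_eventually)
    have "\<forall>\<^sub>F z in at 0. f z \<noteq> 0" "\<forall>\<^sub>F z in at 0. E (f z) = z" "\<forall>\<^sub>F z in at 0. z \<noteq> (0::complex)"
      using f0(1) E(2) by (auto simp: filterlim_at eventually_at_filter elim: eventually_mono)
    with ne show "\<forall>\<^sub>F z in at 0. (E (h (f z)) - E (f z)) / (h (f z) - f z) * ((h (f z) - f z) / f z ^ Suc n) * (f z / z) ^ Suc n
      = (E (h (f z)) - z) / z ^ Suc n"
      by eventually_elim (simp add: power_divide del: power_Suc)
  qed
qed

text \<open>Unless it vanishes near 0, h(z) - z has a zero of finite order m at 0, and h'(0) = 1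
  rules out m = 1. The order is written \<open>Suc n\<close> because conjugation by f multiplies a
  by the n-th power of the multiplier.\<close>

lemma tangent_to_id_leading_term:
  assumes "is_diff_germ h" "deriv h 0 = 1" "\<not> same_germ h id"
  obtains n a where "n > 0" "a \<noteq> 0" "((\<lambda>z. (h z - z) / z ^ Suc n) \<longlongrightarrow> a) (at 0)"
proof -
  obtain r where r: "r > 0" "h holomorphic_on ball 0 r"
    using assms(1) by (auto simp: is_diff_germ_iff analytic_at_ball)
  have h0: "h 0 = 0"
    using assms(1) by (simp add: is_diff_germ_iff)
  have nc: "\<not> (\<lambda>z. h z - z) constant_on ball 0 r"
  proof
    assume "(\<lambda>z. h z - z) constant_on ball 0 r"
    then obtain c where c: "\<And>z. z \<in> ball 0 r \<Longrightarrow> h z - z = c"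
      by (auto simp: constant_on_def)
    from c[of 0] have "c = 0"
      using h0 r(1) by simp
    then show False
      using assms(3) c r(1) by (force simp: same_germ_def)
  qed
  have hol: "(\<lambda>z. h z - z) holomorphic_on ball 0 r"
    using r(2) by (intro holomorphic_intros)
  have zero: "0 \<in> ball 0 r" "h 0 - 0 = 0"
    using r(1) h0 by simp_all
  obtain g s m where g: "0 < m" "0 < s" "ball 0 s \<subseteq> ball (0::complex) r" "g holomorphic_on ball 0 s"
    "\<And>w. w \<in> ball 0 s \<Longrightarrow> h w - w = (w - 0) ^ m * g w" "\<And>w. w \<in> ball 0 s \<Longrightarrow> g w \<noteq> 0"
    by (rule holomorphic_factor_zero_nonconstant[OF hol open_ball connected_ball zero nc]) blast
  have "isCont g 0"
    using g(2,4) analytic_at_imp_isCont analytic_at_ball by blast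
  then have gl: "(g \<longlongrightarrow> g 0) (at 0)"
    by (simp add: isCont_def)
  have ev: "\<forall>\<^sub>F w in at 0. w \<in> ball 0 s - {0}"
    using eventually_at_in_open[of "ball 0 s" 0] g(2) by simp
  have lim: "((\<lambda>z. (h z - z) / z ^ m) \<longlongrightarrow> g 0) (at 0)"
    using ev by (intro Lim_transform_eventually[OF gl]) (auto elim!: eventually_mono simp: g(5))
  have "m \<noteq> 1"
  proof
    assume "m = 1"
    with lim have 1: "((\<lambda>z. (h z - z) / z) \<longlongrightarrow> g 0) (at 0)"
      by simp
    have "((\<lambda>z. h z / z - 1) \<longlongrightarrow> 1 - 1) (at 0)"
      using germ_has_field_derivative[OF assms(1)] assms(2) h0
      by (intro tendsto_intros) (simp add: has_field_derivative_iff)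
    moreover have "\<forall>\<^sub>F z in at 0. h z / z - 1 = (h z - z) / z"
      using ev by eventually_elim (auto simp: field_simps)
    ultimately have "((\<lambda>z. (h z - z) / z) \<longlongrightarrow> 1 - 1) (at 0)"
      by (rule Lim_transform_eventually)
    with 1 have "g 0 = 1 - 1"
      by (rule tendsto_unique[OF at_neq_bot])
    then show False
      using g(2,6) by force
  qed
  then have "m - 1 > 0" "Suc (m - 1) = m"
    using g(1) by auto
  then show ?thesis
    using that[of "m - 1" "g 0"] lim g(2,6) by auto
qed

section \<open>Rigidity at points of maximal modulus\<close>

lemma sum_power_bound:
  fixes w :: complex
  assumes "norm w = 1" "w \<noteq> 1"
  shows "norm (\<Sum>j<N. w ^ j) \<le> 2 / norm (1 - w)"
proof -
  have "(\<Sum>j<N. w ^ j) = (1 - w ^ N) / (1 - w)"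
    using assms(2) by (simp add: sum_gp_strict)
  moreover have "norm (1 - w ^ N) \<le> 2"
    using norm_triangle_ineq4[of 1 "w ^ N"] assms(1) by (simp add: norm_power)
  ultimately show ?thesis
    by (simp add: norm_divide divide_right_mono)
qed

text \<open>If all x_j = Re (u w^j) lay below 1/4, then (x_j + 1)(1/4 - x_j) \<ge> 0 would bound the mean of x_j^2
  by about 1/4, as the x_j have mean nearly 0; but x_j^2 = (1 + Re (u^2 w^{2j})) / 2 has mean nearly 1/2.\<close>

lemma rotation_enters_half_plane:
  fixes w :: complex
  assumes w: "norm w = 1" "w \<noteq> 1" "w\<^sup>2 \<noteq> 1"
  obtains N :: nat where "\<And>u. norm u = 1 \<Longrightarrow> \<exists>j<N. Re (u * w ^ j) \<ge> 1/4"
proof -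
  \<comment> \<open>Summing the pointwise inequality over j < N yields N/4 \<le> 3/4 |sum of Re(u
    w^j)| + 1/2 |sum of Re(u^2 w^{2j})|. The geometric sums bound the right side by
    \<open>B\<close>, whatever u is; so N > 4 B contradicts it for all u at once.\<close>
  define B where "B = 3 / 4 * (2 / norm (1 - w)) + 1 / 2 * (2 / norm (1 - w\<^sup>2))"
  obtain N :: nat where N: "real N > 4 * B"
    using reals_Archimedean2 by blast
  have "\<exists>j<N. Re (u * w ^ j) \<ge> 1/4" if u: "norm u = 1" for u
  proof (rule ccontr)
    assume "\<not> ?thesis"
    then have small: "\<And>j. j < N \<Longrightarrow> Re (u * w ^ j) < 1/4"
      by (auto simp: not_le)
    have pt: "1 / 2 + Re (u\<^sup>2 * (w\<^sup>2) ^ j) / 2 \<le> 1 / 4 - 3 / 4 * Re (u * w ^ j)" if "j < N" for j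
    proof -
      define z where "z = u * w ^ j"
      have eq: "u\<^sup>2 * (w\<^sup>2) ^ j = z\<^sup>2"
        by (simp add: z_def power_mult_distrib flip: power_mult) (simp add: mult.commute)
      have nz: "norm z = 1"
        using u w(1) by (simp add: z_def norm_mult norm_power)
      then have "(Re z)\<^sup>2 + (Im z)\<^sup>2 = 1"
        by (metis cmod_power2 one_power2)
      moreover have "Re (z\<^sup>2) = (Re z)\<^sup>2 - (Im z)\<^sup>2"
        by (simp add: power2_eq_square)
      moreover have "Re z \<ge> -1"
        using abs_Re_le_cmod[of z] nz by linarith
      then have "(Re z + 1) * (1/4 - Re z) \<ge> 0"
        using small[OF that] by (intro mult_nonneg_nonneg) (auto simp: z_def)
      then have "(Re z)\<^sup>2 \<le> 1 / 4 - 3 / 4 * Re z"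
        by (simp add: power2_eq_square algebra_simps)
      ultimately have "1 / 2 + Re (z\<^sup>2) / 2 \<le> 1 / 4 - 3 / 4 * Re z"
        by (simp add: field_simps)
      then show ?thesis
        by (simp only: eq) (simp only: z_def)
    qed
    have bd: "\<bar>Re (\<Sum>j<N. c * v ^ j)\<bar> \<le> 2 / norm (1 - v)" if "norm c = 1" "norm v = 1" "v \<noteq> 1" for c v :: complex
    proof -
      have "\<bar>Re (\<Sum>j<N. c * v ^ j)\<bar> \<le> norm (c * (\<Sum>j<N. v ^ j))"
        unfolding sum_distrib_left[symmetric] by (rule abs_Re_le_cmod)
      also have "\<dots> \<le> 2 / norm (1 - v)"
        using sum_power_bound[OF that(2,3), of N] that(1) by (simp add: norm_mult)
      finally show ?thesis .
    qed
    have "(\<Sum>j<N. 1 / 2 + Re (u\<^sup>2 * (w\<^sup>2) ^ j) / 2) \<le> (\<Sum>j<N. 1 / 4 - 3 / 4 * Re (u * w ^ j))"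
      by (intro sum_mono pt) simp
    then have "N / 2 + Re (\<Sum>j<N. u\<^sup>2 * (w\<^sup>2) ^ j) / 2 \<le> N / 4 - 3 / 4 * Re (\<Sum>j<N. u * w ^ j)"
      by (simp add: sum.distrib sum_subtractf Re_sum flip: sum_divide_distrib sum_distrib_left)
    moreover have "\<bar>Re (\<Sum>j<N. u\<^sup>2 * (w\<^sup>2) ^ j)\<bar> \<le> 2 / norm (1 - w\<^sup>2)"
      using w u by (intro bd) (auto simp: norm_power)
    moreover have "\<bar>Re (\<Sum>j<N. u * w ^ j)\<bar> \<le> 2 / norm (1 - w)"
      using w u by (intro bd) auto
    moreover have False if "real N / 2 + s / 2 \<le> real N / 4 - 3 / 4 * t" "\<bar>s\<bar> \<le> b" "\<bar>t\<bar> \<le> c"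
      "real N > 4 * (3 / 4 * c + 1 / 2 * b)" for s t b c :: real
      using that by argo
    ultimately show False
      using N unfolding B_def by blast
  qed
  then show ?thesis
    using that by blast
qed

lemma germ_funpow:
  "is_diff_germ f \<Longrightarrow> is_diff_germ (f ^^ j) \<and> deriv (f ^^ j) 0 = deriv f 0 ^ j"
proof (induction j)
  case 0
  then show ?case
    using germ_id by (simp add: id_def)
next
  case (Suc j)
  then show ?case
    by (simp add: germ_comp germ_deriv_comp del: o_apply)
qed

lemma eventually_nhds_0_subset:
  fixes P :: "complex \<Rightarrow> bool"
  assumes "\<forall>\<^sub>F z in nhds 0. P z"
  obtains d where "d > 0" "\<And>z. z \<in> ball 0 d \<Longrightarrow> P z"
  using assms by (auto simp: eventually_nhds_metric dist_norm)

lemma tangent_to_id_rigid: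
  assumes f: "is_diff_germ f" and lam: "norm (deriv f 0) = 1" "\<And>n. n > 0 \<Longrightarrow> deriv f 0 ^ n \<noteq> 1"
    and h: "is_diff_germ h" "deriv h 0 = 1"
    and K: "\<And>d. d > 0 \<Longrightarrow> \<exists>K. compact K \<and> 0 \<in> K \<and> K \<noteq> {0} \<and> K \<subseteq> ball 0 d \<and> f ` K = K \<and> h ` K = K"
  shows "same_germ h id"
proof (rule ccontr)
  assume "\<not> same_germ h id"
  then obtain n a where n: "n > 0" "a \<noteq> 0" "((\<lambda>z. (h z - z) / z ^ Suc n) \<longlongrightarrow> a) (at 0)"
    using tangent_to_id_leading_term h by metis
  \<comment> \<open>Conjugation by f^j multiplies the leading coefficient by \<open>w ^ j\<close>.
    That \<lambda> is no root of unity is used at the exponents n and 2n.\<close>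
  define w where "w = deriv f 0 ^ n"
  have w: "norm w = 1" "w \<noteq> 1" "w\<^sup>2 \<noteq> 1"
    using lam n(1) by (auto simp: w_def norm_power simp flip: power_mult)
  obtain N where N: "\<And>u. norm u = 1 \<Longrightarrow> \<exists>j<N. Re (u * w ^ j) \<ge> 1/4"
    using rotation_enters_half_plane[OF w] by blast
  have "\<exists>E. is_diff_germ E \<and> (\<forall>\<^sub>F z in nhds 0. E ((f ^^ j) z) = z)" for j
    using germ_inverse[of "f ^^ j"] germ_funpow[OF f, of j] by metis
  then obtain E where E: "\<And>j. is_diff_germ (E j)" "\<And>j. \<forall>\<^sub>F z in nhds 0. E j ((f ^^ j) z) = z"
    by metis
  define hj where "hj = (\<lambda>j z. E j (h ((f ^^ j) z)))"
  have lim: "((\<lambda>z. (hj j z - z) / z ^ Suc n) \<longlongrightarrow> a * w ^ j) (at 0)" for j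
    using conj_leading_term[OF _ E(1) E(2) h(1) n(3,2), of j] germ_funpow[OF f, of j]
    by (simp add: hj_def w_def mult.commute flip: power_mult)
  have "\<forall>\<^sub>F z in at 0. dist ((hj j z - z) / z ^ Suc n) (a * w ^ j) < norm a / 4" for j
    using n(2) by (intro tendstoD[OF lim]) simp
  then have "\<forall>\<^sub>F z in at 0. \<forall>j\<in>{..<N}. dist ((hj j z - z) / z ^ Suc n) (a * w ^ j) < norm a / 4"
    by (intro eventually_ball_finite) auto
  moreover have "\<forall>\<^sub>F z in nhds 0. \<forall>j\<in>{..<N}. E j ((f ^^ j) z) = z"
    using E(2) by (intro eventually_ball_finite) auto
  ultimately have "\<forall>\<^sub>F z in nhds 0. \<forall>j\<in>{..<N}. E j ((f ^^ j) z) = z \<and>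
    (z \<noteq> 0 \<longrightarrow> dist ((hj j z - z) / z ^ Suc n) (a * w ^ j) < norm a / 4)"
    unfolding eventually_at_filter by eventually_elim auto
  \<comment> \<open>One disc for all j < N, fixed before K and p exist. The tolerance
    \<open>norm a / 4\<close> matches the 1/4 of the half plane: the error stays strictly below the
    outward push.\<close>
  then obtain d where d: "d > 0" "\<And>z j. z \<in> ball 0 d \<Longrightarrow> j < N \<Longrightarrow> E j ((f ^^ j) z) = z"
    "\<And>z j. z \<in> ball 0 d \<Longrightarrow> j < N \<Longrightarrow> z \<noteq> 0 \<Longrightarrow> dist ((hj j z - z) / z ^ Suc n) (a * w ^ j) < norm a / 4"
    by (rule eventually_nhds_0_subset) auto
  obtain K where K: "compact K" "0 \<in> K" "K \<noteq> {0}" "K \<subseteq> ball 0 d" "f ` K = K" "h ` K = K"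
    using K[OF d(1)] by blast
  obtain p where p: "p \<in> K" "\<And>z. z \<in> K \<Longrightarrow> norm z \<le> norm p"
    using continuous_attains_sup[OF K(1), of norm] K(2) by (auto intro: continuous_on_norm_id)
  have p0: "p \<noteq> 0"
    using p(2) K(2,3) by fastforce
  have fK: "(f ^^ j) ` K = K" for j
    by (induction j) (simp_all add: image_comp[symmetric] K(5) del: o_apply)
  \<comment> \<open>Adding c p^{n+1} to p multiplies it by 1 + c p^n, so Re(c p^n) > 0 makes the
    modulus grow. Here c is nearly a w^j, and \<open>u\<close> is the direction of a p^n.\<close>
  define u where "u = a * p ^ n / of_real (norm a * norm p ^ n)"
  have nu: "norm u = 1" and au: "a * p ^ n = of_real (norm a * norm p ^ n) * u"
    using n(2) p0 by (auto simp: u_def norm_divide norm_mult norm_power)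
  obtain j where j: "j < N" "Re (u * w ^ j) \<ge> 1/4"
    using N[OF nu] by blast
  have "h ((f ^^ j) p) \<in> K"
    using p(1) fK[of j] K(6) by blast
  \<comment> \<open>\<open>E j\<close> is known to invert f^j only on the small disc. Writing
    h(f^j(p)) as f^j(q) with q in K shows that \<open>hj j p\<close> is q.\<close>
  then obtain q where "q \<in> K" "h ((f ^^ j) p) = (f ^^ j) q"
    using fK[of j] by (metis imageE)
  then have "hj j p \<in> K"
    using d(2)[of q j] j(1) K(4) by (auto simp: hj_def)
  then have le: "norm (hj j p) \<le> norm p"
    by (rule p(2))
  define e where "e = (hj j p - p) / p ^ Suc n - a * w ^ j"
  have e: "norm e < norm a / 4"
    using d(3)[OF _ j(1) p0] p(1) K(4) by (auto simp: e_def dist_norm)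
  have eq: "hj j p = p * (1 + (a * w ^ j + e) * p ^ n)"
    using p0 by (simp add: e_def field_simps)
  have pos: "norm p ^ n > 0"
    using p0 by simp
  have "Re (a * p ^ n * w ^ j) = norm a * norm p ^ n * Re (u * w ^ j)"
  proof -
    have "a * p ^ n * w ^ j = (norm a * norm p ^ n) *\<^sub>R (u * w ^ j)"
      unfolding au by (simp add: scaleR_conv_of_real)
    then show ?thesis
      by (simp only: scaleR_complex.sel)
  qed
  also have "\<dots> \<ge> norm a * norm p ^ n * (1/4)"
    using j(2) by (intro mult_left_mono) auto
  finally have 1: "Re (a * p ^ n * w ^ j) \<ge> norm a / 4 * norm p ^ n"
    by simp
  have "\<bar>Re (e * p ^ n)\<bar> \<le> norm e * norm p ^ n"
    using abs_Re_le_cmod[of "e * p ^ n"] by (simp add: norm_mult norm_power)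
  also have "\<dots> < norm a / 4 * norm p ^ n"
    using e pos by (rule mult_strict_right_mono)
  finally have 2: "Re (e * p ^ n) > - (norm a / 4 * norm p ^ n)"
    by linarith
  have "Re (1 + (a * w ^ j + e) * p ^ n) = 1 + Re (a * p ^ n * w ^ j) + Re (e * p ^ n)"
  proof -
    have "1 + (a * w ^ j + e) * p ^ n = 1 + a * p ^ n * w ^ j + e * p ^ n"
      by (simp add: algebra_simps)
    then show ?thesis
      by (simp only: plus_complex.sel one_complex.sel)
  qed
  also have "\<dots> > 1"
    using 1 2 by linarith
  finally have "1 < norm (1 + (a * w ^ j + e) * p ^ n)"
    using complex_Re_le_cmod[of "1 + (a * w ^ j + e) * p ^ n"] by linarith
  then have "norm p * 1 < norm (hj j p)"
    unfolding eq norm_mult[of p] using p0 by (intro mult_strict_left_mono) auto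
  with le show False
    by simp
qed

section \<open>Koenigs linearization of contracting germs\<close>

text \<open>Orbits cannot leave a disc on which |g(z)| \<le> s |z|, so what holds on that disc holds
  along whole forward orbits. \<open>P\<close> is left free so that domains, remainder bounds or
  commutation can be carried along for all n on one disc.\<close>

lemma attracting_orbit:
  assumes g: "is_diff_germ g" and s: "norm (deriv g 0) < s" "s < 1" and P: "\<forall>\<^sub>F z in nhds 0. P z"
  shows "\<forall>\<^sub>F z in nhds 0. \<forall>n. P ((g ^^ n) z) \<and> norm ((g ^^ n) z) \<le> s ^ n * norm z"
proof -
  have g0: "g 0 = 0"
    using g by (simp add: is_diff_germ_iff)
  have "s > 0"
    using s(1) norm_ge_zero[of "deriv g 0"] by linarith
  have "((\<lambda>z. norm (g z / z)) \<longlongrightarrow> norm (deriv g 0)) (at 0)"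
    using germ_has_field_derivative[OF g] g0 by (intro tendsto_norm) (simp add: has_field_derivative_iff)
  then have "\<forall>\<^sub>F z in at 0. norm (g z / z) < s"
    using s(1) by (rule order_tendstoD)
  then have "\<forall>\<^sub>F z in nhds 0. norm (g z) \<le> s * norm z"
    unfolding eventually_at_filter
    by eventually_elim (auto simp: g0 norm_divide divide_less_eq split: if_splits)
  with P have "\<forall>\<^sub>F z in nhds 0. P z \<and> norm (g z) \<le> s * norm z"
    by (rule eventually_conj)
  then obtain d where d: "d > 0" "\<And>z. z \<in> ball 0 d \<Longrightarrow> P z \<and> norm (g z) \<le> s * norm z"
    by (rule eventually_nhds_0_subset) blast
  have orbit: "norm ((g ^^ n) z) \<le> s ^ n * norm z \<and> (g ^^ n) z \<in> ball 0 d" if z: "z \<in> ball 0 d" for n z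
  proof (induction n)
    case (Suc n)
    then have "norm ((g ^^ Suc n) z) \<le> s * norm ((g ^^ n) z)"
      using d(2) by simp
    also have "\<dots> \<le> s * (s ^ n * norm z)"
      using Suc \<open>s > 0\<close> by (intro mult_left_mono) auto
    finally have *: "norm ((g ^^ Suc n) z) \<le> s ^ Suc n * norm z"
      by (simp add: mult.assoc)
    also have "\<dots> \<le> 1 * norm z"
      using s(2) \<open>s > 0\<close> by (intro mult_right_mono power_le_one) auto
    finally show ?case
      using * z by simp
  qed (use z in simp)
  have "\<forall>\<^sub>F z in nhds 0. z \<in> ball (0::complex) d"
    using d(1) by (intro eventually_nhds_in_open) auto
  then show ?thesis
    by eventually_elim (use orbit d(2) in blast)
qed

text \<open>The increment of g^n / \<mu>^n is the quadratic remainder of g at g^n(z) divided by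
  \<mu>^{n+1}, of size s^{2n} / |\<mu>|^{n+1} up to a constant. Contraction at rate s needs |\<mu>|
  < s, and summability needs s^2 < |\<mu>|; hence s is taken between |\<mu>| and its square
  root.\<close>

lemma koenigs:
  assumes g: "is_diff_germ g" and mu: "norm (deriv g 0) < 1"
  obtains \<phi> where "is_diff_germ \<phi>" "deriv \<phi> 0 = 1"
    "\<forall>\<^sub>F z in nhds 0. (\<lambda>n. (g ^^ n) z / deriv g 0 ^ n) \<longlonglongrightarrow> \<phi> z"
proof -
  define \<mu> where "\<mu> = deriv g 0"
  have mu0: "\<mu> \<noteq> 0" and g0: "g 0 = 0"
    using g by (auto simp: \<mu>_def is_diff_germ_iff)
  have "norm \<mu> < sqrt (norm \<mu>)"
    using mu mu0 by (intro real_less_rsqrt) (simp add: \<mu>_def power2_eq_square)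
  then obtain s where s: "norm \<mu> < s" "s < sqrt (norm \<mu>)"
    using dense by blast
  have "s > 0"
    using s(1) norm_ge_zero[of \<mu>] by linarith
  have "s\<^sup>2 < norm \<mu>"
    using power_strict_mono[OF s(2), of 2] \<open>s > 0\<close> by simp
  moreover have "s < 1"
    using s(2) mu real_sqrt_lt_1_iff[of "norm \<mu>"] unfolding \<mu>_def by linarith
  define q where "q = s\<^sup>2 / norm \<mu>"
  have q: "0 \<le> q" "q < 1"
    using \<open>s\<^sup>2 < norm \<mu>\<close> mu0 by (auto simp: q_def)
  \<comment> \<open>The quadratic remainder comes from the germ g / \<mu>, which is tangent to the
    identity: its leading exponent is at least 2, and higher powers of |z| are below |z|^2 in the
    unit disc. The case of g linear near 0 takes C = 0.\<close>
  have "\<exists>C\<ge>0. \<forall>\<^sub>F z in nhds 0. norm (g z - \<mu> * z) \<le> C * norm z ^ 2"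
  proof -
    define h where "h = (\<lambda>z. inverse \<mu> * g z)"
    have h: "is_diff_germ h" "deriv h 0 = 1"
    proof -
      have "deriv h 0 = inverse \<mu> * \<mu>"
        using germ_has_field_derivative[OF g] unfolding h_def
        by (intro DERIV_imp_deriv DERIV_cmult) (simp add: \<mu>_def)
      then show "deriv h 0 = 1"
        using mu0 by simp
      then show "is_diff_germ h"
        using g by (auto simp: is_diff_germ_iff h_def intro!: analytic_intros)
    qed
    have gh: "norm (g z - \<mu> * z) = norm \<mu> * norm (h z - z)" for z
    proof -
      have "g z - \<mu> * z = \<mu> * (h z - z)"
        using mu0 by (simp add: h_def right_diff_distrib)
      then show ?thesis
        by (simp add: norm_mult)
    qed
    show ?thesis
    proof (cases "same_germ h id")
      case True
      then have "\<forall>\<^sub>F z in nhds 0. norm (g z - \<mu> * z) \<le> 0 * norm z ^ 2"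
        unfolding same_germ_iff_eventually by eventually_elim (simp add: gh)
      then show ?thesis
        by blast
    next
      case False
      then obtain n a where n: "n > 0" "((\<lambda>z. (h z - z) / z ^ Suc n) \<longlongrightarrow> a) (at 0)"
        using tangent_to_id_leading_term[OF h] by metis
      have "\<forall>\<^sub>F z in at 0. norm ((h z - z) / z ^ Suc n) < norm a + 1"
        using tendsto_norm[OF n(2)] by (rule order_tendstoD) simp
      moreover have "\<forall>\<^sub>F z in nhds 0. z \<in> ball (0::complex) 1"
        by (intro eventually_nhds_in_open) auto
      ultimately have "\<forall>\<^sub>F z in nhds 0. norm (g z - \<mu> * z) \<le> norm \<mu> * (norm a + 1) * norm z ^ 2"
        unfolding eventually_at_filter
      proof eventually_elim
        case (elim z)
        show ?case
        proof (cases "z = 0")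
          case False
          then have "norm (h z - z) \<le> (norm a + 1) * norm z ^ Suc n"
            using elim by (simp add: norm_divide norm_power norm_mult divide_less_eq)
          also have "\<dots> \<le> (norm a + 1) * norm z ^ 2"
            using elim n(1) by (intro mult_left_mono power_decreasing) auto
          finally show ?thesis
            unfolding gh mult.assoc by (intro mult_left_mono) auto
        qed (simp add: g0)
      qed
      then show ?thesis
        by (intro exI[of _ "norm \<mu> * (norm a + 1)"]) auto
    qed
  qed
  then obtain C where C: "C \<ge> 0" "\<forall>\<^sub>F z in nhds 0. norm (g z - \<mu> * z) \<le> C * norm z ^ 2"
    by blast
  obtain R where R: "R > 0" "g holomorphic_on ball 0 R"
    using g by (auto simp: is_diff_germ_iff analytic_at_ball)
  have "\<forall>\<^sub>F z in nhds 0. z \<in> ball (0::complex) R"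
    using R(1) by (intro eventually_nhds_in_open) auto
  from attracting_orbit[OF g s(1)[unfolded \<mu>_def] \<open>s < 1\<close> eventually_conj[OF this C(2)]]
  have "\<forall>\<^sub>F z in nhds 0. z \<in> ball (0::complex) 1 \<and> (\<forall>n. ((g ^^ n) z \<in> ball 0 R \<and>
    norm (g ((g ^^ n) z) - \<mu> * (g ^^ n) z) \<le> C * norm ((g ^^ n) z) ^ 2) \<and> norm ((g ^^ n) z) \<le> s ^ n * norm z)"
    by (intro eventually_conj eventually_nhds_in_open) auto
  then obtain r where r: "r > 0" "\<And>z. z \<in> ball 0 r \<Longrightarrow> z \<in> ball (0::complex) 1"
    "\<And>n z. z \<in> ball 0 r \<Longrightarrow> (g ^^ n) z \<in> ball 0 R"
    "\<And>n z. z \<in> ball 0 r \<Longrightarrow> norm (g ((g ^^ n) z) - \<mu> * (g ^^ n) z) \<le> C * norm ((g ^^ n) z) ^ 2"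
    "\<And>n z. z \<in> ball 0 r \<Longrightarrow> norm ((g ^^ n) z) \<le> s ^ n * norm z"
    by (rule eventually_nhds_0_subset) blast
  define F where "F = (\<lambda>n z. (g ^^ n) z / \<mu> ^ n)"
  have hol: "F n holomorphic_on ball 0 r" for n
  proof -
    have "(g ^^ n) holomorphic_on ball 0 r"
    proof (induction n)
      case (Suc n)
      have "g \<circ> (g ^^ n) holomorphic_on ball 0 r"
        using Suc R(2) by (rule holomorphic_on_compose_gen) (use r(3) in auto)
      then show ?case
        by (simp add: o_def)
    qed (simp add: holomorphic_on_id)
    then show ?thesis
      unfolding F_def using mu0 by (intro holomorphic_intros) auto
  qed
  have step: "norm (F (Suc n) z - F n z) \<le> C / norm \<mu> * q ^ n" if z: "z \<in> ball 0 r" for n z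
  proof -
    let ?w = "(g ^^ n) z"
    have "norm ?w \<le> s ^ n * 1"
      using r(5)[OF z, of n] r(2)[OF z] \<open>s > 0\<close>
      by (elim order_trans) (intro mult_left_mono, auto)
    then have "norm ?w ^ 2 \<le> (s ^ n) ^ 2"
      by (intro power_mono) auto
    then have "norm (g ?w - \<mu> * ?w) \<le> C * (s ^ n) ^ 2"
      using r(4)[OF z, of n] C(1) by (meson mult_left_mono order_trans)
    moreover have "F (Suc n) z - F n z = (g ?w - \<mu> * ?w) / \<mu> ^ Suc n"
      using mu0 by (simp add: F_def field_simps)
    ultimately have "norm (F (Suc n) z - F n z) \<le> C * (s ^ n) ^ 2 / norm \<mu> ^ Suc n"
      by (simp add: norm_divide norm_power norm_mult divide_right_mono)
    also have "\<dots> = C / norm \<mu> * q ^ n"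
      by (simp add: q_def power_divide power_mult[symmetric] mult.commute)
    finally show ?thesis .
  qed
  \<comment> \<open>As \<open>F 0\<close> is the identity, the partial sums of this telescoping
    series are the maps \<open>F n\<close>; the series form lets the M-test use the bound on
    increments.\<close>
  define \<phi> where "\<phi> = (\<lambda>z. z + (\<Sum>i. F (Suc i) z - F i z))"
  have "uniform_limit (ball 0 r) (\<lambda>n z. \<Sum>i<n. F (Suc i) z - F i z) (\<lambda>z. \<Sum>i. F (Suc i) z - F i z) sequentially"
    using step q by (intro Weierstrass_m_test[where M = "\<lambda>n. C / norm \<mu> * q ^ n"] summable_mult summable_geometric) auto
  then have "uniform_limit (ball 0 r) (\<lambda>n z. z + (\<Sum>i<n. F (Suc i) z - F i z)) \<phi> sequentially"
    unfolding \<phi>_def by (intro uniform_limit_intros)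
  moreover have "(\<lambda>n z. z + (\<Sum>i<n. F (Suc i) z - F i z)) = F"
  proof -
    have "F 0 z = z" for z
      by (simp add: F_def)
    then show ?thesis
      using sum_lessThan_telescope[of "\<lambda>i. F i z" n for z n] by (simp add: fun_eq_iff)
  qed
  ultimately have ul: "uniform_limit (ball 0 r) F \<phi> sequentially"
    by simp
  \<comment> \<open>Locally uniform limits of holomorphic maps are holomorphic and their derivatives
    converge too. This gives \<phi>'(0) = 1 as the limit of the constant sequence of derivatives at
    0.\<close>
  have "\<exists>d>0. cball x d \<subseteq> ball 0 r \<and> uniform_limit (cball x d) F \<phi> sequentially" if "x \<in> ball 0 r" for x
    using that ul by (meson open_ball open_contains_cball uniform_limit_on_subset)
  moreover have "(F n has_field_derivative deriv (F n) x) (at x)" if "x \<in> ball 0 r" for n x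
    using hol that by (intro holomorphic_derivI[of _ "ball 0 r"]) auto
  ultimately have "\<exists>\<phi>'. \<forall>x\<in>ball 0 r. (\<phi> has_field_derivative \<phi>' x) (at x) \<and>
      (\<lambda>n. deriv (F n) x) \<longlonglongrightarrow> \<phi>' x"
    by (intro has_complex_derivative_uniform_sequence) auto
  then obtain \<phi>' where der: "\<And>x. x \<in> ball 0 r \<Longrightarrow> (\<phi> has_field_derivative \<phi>' x) (at x)"
    "\<And>x. x \<in> ball 0 r \<Longrightarrow> (\<lambda>n. deriv (F n) x) \<longlonglongrightarrow> \<phi>' x"
    by blast
  have "deriv (F n) 0 = 1" for n
  proof -
    have "((g ^^ n) has_field_derivative \<mu> ^ n) (at 0)"
      using germ_funpow[OF g, of n] germ_has_field_derivative[of "g ^^ n"] by (simp add: \<mu>_def)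
    then have "deriv (F n) 0 = \<mu> ^ n / \<mu> ^ n"
      unfolding F_def by (intro DERIV_imp_deriv DERIV_cdivide)
    then show ?thesis
      using mu0 by simp
  qed
  then have "\<phi>' 0 = 1"
    using der(2)[of 0] r(1) by (simp add: LIMSEQ_const_iff)
  then have d1: "deriv \<phi> 0 = 1"
    using der(1)[of 0] r(1) by (simp add: DERIV_imp_deriv)
  have lim: "(\<lambda>n. F n z) \<longlonglongrightarrow> \<phi> z" if "z \<in> ball 0 r" for z
    using ul that by (rule tendsto_uniform_limitI)
  have "(g ^^ n) 0 = 0" for n
    by (induction n) (auto simp: g0)
  then have "\<phi> 0 = 0"
    using lim[of 0] r(1) by (simp add: F_def LIMSEQ_const_iff)
  moreover have "\<phi> analytic_on {0}"
    using der(1) r(1) unfolding analytic_at_ball by (meson holomorphic_on_open open_ball)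
  ultimately have "is_diff_germ \<phi>"
    using d1 by (simp add: is_diff_germ_iff)
  moreover have "\<forall>\<^sub>F z in nhds 0. z \<in> ball (0::complex) r"
    using r(1) by (intro eventually_nhds_in_open) auto
  then have "\<forall>\<^sub>F z in nhds 0. (\<lambda>n. (g ^^ n) z / deriv g 0 ^ n) \<longlonglongrightarrow> \<phi> z"
    by eventually_elim (use lim in \<open>simp add: F_def \<mu>_def\<close>)
  ultimately show ?thesis
    using d1 that by blast
qed

text \<open>By commutation, g^n(f(z)) / \<mu>^n is f(g^n(z)) / g^n(z) times g^n(z) / \<mu>^n. Since
  g^n(z) tends to 0, the first factor tends to \<lambda>, so the Koenigs coordinate satisfies
  \<phi>(f(z)) = \<lambda> \<phi>(z). Its local inverse is the linearizing map.\<close>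

lemma linearizable_if_commutes_with_contraction:
  assumes f: "is_diff_germ f" and df: "deriv f 0 = exp (2 * pi * \<i> * complex_of_real \<alpha>)"
    and g: "is_diff_germ g" "norm (deriv g 0) < 1"
    and comm: "\<forall>\<^sub>F z in nhds 0. f (g z) = g (f z)"
  shows "linearizable f \<alpha>"
proof -
  define \<mu> where "\<mu> = deriv g 0"
  obtain \<phi> where \<phi>: "is_diff_germ \<phi>" "deriv \<phi> 0 = 1"
    "\<forall>\<^sub>F z in nhds 0. (\<lambda>n. (g ^^ n) z / \<mu> ^ n) \<longlonglongrightarrow> \<phi> z"
    using koenigs[OF g] unfolding \<mu>_def by blast
  obtain s where s: "norm (deriv g 0) < s" "s < 1"
    using dense[OF g(2)] by blast
  have "\<forall>\<^sub>F z in at 0. g z \<noteq> 0"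
    using germ_filterlim_at[OF g(1)] by (simp add: filterlim_at)
  then have "\<forall>\<^sub>F z in nhds 0. f (g z) = g (f z) \<and> (z \<noteq> 0 \<longrightarrow> g z \<noteq> 0)"
    using comm unfolding eventually_at_filter by eventually_elim auto
  from attracting_orbit[OF g(1) s this] \<phi>(3) eventually_germ[OF f \<phi>(3)]
  have semi: "\<forall>\<^sub>F z in nhds 0. \<phi> (f z) = deriv f 0 * \<phi> z"
  proof eventually_elim
    case (elim z)
    show ?case
    proof (cases "z = 0")
      case True
      then show ?thesis
        using f \<phi>(1) by (simp add: is_diff_germ_iff)
    next
      case False
      have comm_n: "(g ^^ n) (f z) = f ((g ^^ n) z)" for n
        by (induction n) (use elim(1) in auto)
      have bound: "norm ((g ^^ n) z) \<le> s ^ n * norm z" for n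
        using elim(1) by blast
      \<comment> \<open>The limit of f(w)/w is taken along w = g^n(z), so the orbit must avoid 0.
        This is why nonvanishing was carried along with commutation.\<close>
      have nz: "(g ^^ n) z \<noteq> 0" for n
        by (induction n) (use elim(1) False in auto)
      have "0 \<le> s"
        using s(1) norm_ge_zero[of "deriv g 0"] by linarith
      then have "(\<lambda>n. s ^ n * norm z) \<longlonglongrightarrow> 0"
        using s(2) by (intro tendsto_mult_left_zero LIMSEQ_power_zero) simp
      then have "(\<lambda>n. (g ^^ n) z) \<longlonglongrightarrow> 0"
        by (rule Lim_null_comparison[OF always_eventually[OF allI[OF bound]]])
      with nz have "filterlim (\<lambda>n. (g ^^ n) z) (at 0) sequentially"
        by (simp add: filterlim_at)
      moreover have "((\<lambda>w. f w / w) \<longlongrightarrow> deriv f 0) (at 0)"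
        using germ_has_field_derivative[OF f] f by (simp add: has_field_derivative_iff is_diff_germ_iff)
      ultimately have "(\<lambda>n. f ((g ^^ n) z) / (g ^^ n) z) \<longlonglongrightarrow> deriv f 0"
        by (rule filterlim_compose[rotated])
      then have "(\<lambda>n. f ((g ^^ n) z) / (g ^^ n) z * ((g ^^ n) z / \<mu> ^ n)) \<longlonglongrightarrow> deriv f 0 * \<phi> z"
        using elim(2) by (rule tendsto_mult)
      moreover have "f ((g ^^ n) z) / (g ^^ n) z * ((g ^^ n) z / \<mu> ^ n) = (g ^^ n) (f z) / \<mu> ^ n" for n
        using nz[of n] by (simp add: comm_n)
      ultimately have "(\<lambda>n. (g ^^ n) (f z) / \<mu> ^ n) \<longlonglongrightarrow> deriv f 0 * \<phi> z"
        by (simp only:)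
      with elim(3) show ?thesis
        by (rule LIMSEQ_unique)
    qed
  qed
  obtain h where h: "is_diff_germ h" "deriv h 0 = 1"
    "\<forall>\<^sub>F z in nhds 0. h (\<phi> z) = z" "\<forall>\<^sub>F z in nhds 0. \<phi> (h z) = z"
    using germ_inverse[OF \<phi>(1), unfolded \<phi>(2) inverse_1] by blast
  have "\<forall>\<^sub>F w in nhds 0. f (h w) = h (rot \<alpha> w)"
    using h(4) eventually_germ[OF h(1) semi] eventually_germ[OF h(1) eventually_germ[OF f h(3)]]
    by eventually_elim (simp add: df rot_def)
  then obtain d where d: "d > 0" "\<And>w. w \<in> ball 0 d \<Longrightarrow> f (h w) = h (rot \<alpha> w)"
    by (rule eventually_nhds_0_subset) blast
  obtain r where r: "diff_rep h r"
    using h(1) by (auto simp: is_diff_germ_def)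
  then have "diff_rep h (min r d)"
    by (rule diff_rep_mono) (use r d(1) in \<open>auto simp: diff_rep_def\<close>)
  then show ?thesis
    using h(2) d(2) unfolding linearizable_def by (intro exI[of _ h] exI[of _ "min r d"]) auto
qed

section \<open>The automorphism group of a germ of compacta\<close>

lemma subset_ball_if_diameter_less:
  fixes K :: "complex set"
  assumes "compact K" "0 \<in> K" "diameter K < e"
  shows "K \<subseteq> ball 0 e"
  using assms diameter_bounded_bound[OF compact_imp_bounded[OF assms(1)] assms(2)] by fastforce

lemma diameter_le_if_subset_ball:
  fixes K :: "complex set"
  assumes "K \<subseteq> ball 0 d" "d > 0"
  shows "diameter K \<le> 2 * d"
  using diameter_subset[OF assms(1)] assms(2) by simp

lemma germ_image_small:
  assumes g: "is_diff_germ g" and e: "e > 0"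
  obtains d where "d > 0" "\<And>K. K \<subseteq> ball 0 d \<Longrightarrow> g ` K \<subseteq> ball 0 e"
    "\<And>K. compact K \<Longrightarrow> K \<subseteq> ball 0 d \<Longrightarrow> compact (g ` K)"
proof -
  obtain r where r: "r > 0" "g holomorphic_on ball 0 r"
    using g by (auto simp: is_diff_germ_iff analytic_at_ball)
  have "\<forall>\<^sub>F z in nhds 0. z \<in> ball (0::complex) e" "\<forall>\<^sub>F z in nhds 0. z \<in> ball (0::complex) r"
    using eventually_nhds_in_open[of "ball 0 e" "0::complex"] eventually_nhds_in_open[of "ball 0 r" "0::complex"] e r(1)
    by simp_all
  then have "\<forall>\<^sub>F z in nhds 0. g z \<in> ball 0 e \<and> z \<in> ball 0 r"
    using eventually_germ[OF g] by (intro eventually_conj)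
  then obtain d where d: "d > 0" "\<And>z. z \<in> ball 0 d \<Longrightarrow> g z \<in> ball 0 e \<and> z \<in> ball 0 r"
    by (rule eventually_nhds_0_subset) blast
  show ?thesis
  proof
    show "g ` K \<subseteq> ball 0 e" if "K \<subseteq> ball 0 d" for K
      using that d(2) by blast
    show "compact (g ` K)" if "compact K" "K \<subseteq> ball 0 d" for K
    proof (rule compact_continuous_image[OF _ that(1)])
      show "continuous_on K g"
        using that(2) d(2) by (intro continuous_on_subset[OF holomorphic_on_imp_continuous_on[OF r(2)]]) blast
    qed
  qed (rule d(1))
qed

lemma germ_equivE:
  assumes "germ_equiv A B"
  obtains e where "e > 0" "\<And>K. compact K \<Longrightarrow> diameter K < e \<Longrightarrow> K \<in> A \<longleftrightarrow> K \<in> B"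
proof -
  from assms obtain e where "e > 0" "\<forall>K. compact K \<and> diameter K < e \<longrightarrow> (K \<in> A \<longleftrightarrow> K \<in> B)"
    unfolding germ_equiv_def by (elim conjE exE)
  with that show thesis
    by simp
qed

text \<open>A germ of compacta records only which small sets are members, so invariance under g
  means that g preserves membership in both directions for small compacta around 0. This removes the
  representative family and the radius of g, and makes composites and inverses easy to handle.
  \<open>small_members\<close> remains because \<open>germ_equiv\<close> includes it.\<close>

lemma Aut_iff:
  assumes KK: "\<And>K. K \<in> \<K> \<Longrightarrow> compact K \<and> 0 \<in> K"
  shows "g \<in> Aut \<K> \<longleftrightarrow> is_diff_germ g \<and> small_members \<K> \<and>
    (\<exists>d>0. \<forall>K. compact K \<and> 0 \<in> K \<and> K \<subseteq> ball 0 d \<longrightarrow> (g ` K \<in> \<K> \<longleftrightarrow> K \<in> \<K>))"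
proof
  assume "g \<in> Aut \<K>"
  then obtain r \<K>' where r: "diff_rep g r" and eq1: "germ_equiv \<K>' \<K>"
    and sub: "\<And>K. K \<in> \<K>' \<Longrightarrow> K \<subseteq> ball 0 r" and eq2: "germ_equiv ((\<lambda>K. g ` K) ` \<K>') \<K>"
    by (auto simp: Aut_def)
  have g: "is_diff_germ g"
    using r by (auto simp: is_diff_germ_def)
  obtain e1 where e1: "e1 > 0" "\<And>K. compact K \<Longrightarrow> diameter K < e1 \<Longrightarrow> K \<in> \<K>' \<longleftrightarrow> K \<in> \<K>"
    by (rule germ_equivE[OF eq1]) blast
  obtain e2 where e2: "e2 > 0"
    "\<And>K. compact K \<Longrightarrow> diameter K < e2 \<Longrightarrow> K \<in> (\<lambda>K. g ` K) ` \<K>' \<longleftrightarrow> K \<in> \<K>"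
    by (rule germ_equivE[OF eq2]) blast
  \<comment> \<open>A subset of a disc of radius e2/3 has diameter at most 2 e2/3 < e2; the bound
    e1/3 in \<open>d\<close> has the same purpose.\<close>
  obtain d0 where d0: "d0 > 0" "\<And>K. K \<subseteq> ball 0 d0 \<Longrightarrow> g ` K \<subseteq> ball 0 (e2 / 3)"
    "\<And>K. compact K \<Longrightarrow> K \<subseteq> ball 0 d0 \<Longrightarrow> compact (g ` K)"
    by (rule germ_image_small[OF g, of "e2 / 3"]) (use e2(1) in simp, blast)
  define d where "d = min d0 (min r (e1 / 3))"
  have d: "d > 0" "d \<le> d0" "d \<le> r" "2 * d < e1"
    using d0(1) e1(1) r by (auto simp: d_def diff_rep_def)
  have "g ` K \<in> \<K> \<longleftrightarrow> K \<in> \<K>" if K: "compact K" "0 \<in> K" "K \<subseteq> ball 0 d" for K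
  proof -
    have K0: "K \<subseteq> ball 0 d0" and Kr: "K \<subseteq> ball 0 r"
      using K(3) d(2,3) subset_ball by (meson order_trans)+
    have "diameter (g ` K) < e2"
      using diameter_le_if_subset_ball[OF d0(2)[OF K0]] e2(1) by simp
    then have "g ` K \<in> \<K> \<longleftrightarrow> g ` K \<in> (\<lambda>K. g ` K) ` \<K>'"
      using e2(2) d0(3)[OF K(1) K0] by blast
    also have "\<dots> \<longleftrightarrow> K \<in> \<K>'"
    proof
      assume "g ` K \<in> (\<lambda>K. g ` K) ` \<K>'"
      then obtain L where L: "L \<in> \<K>'" "g ` K = g ` L"
        by blast
      \<comment> \<open>K and all members of \<open>\<K>'\<close> lie in a disc of injectivity, so
        equal images force equal sets.\<close>
      have "inj_on g (ball 0 r)"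
        using r by (simp add: diff_rep_def)
      then have "K = L"
        using inj_on_image_eq_iff[of g "ball 0 r" K L] L sub Kr by blast
      then show "K \<in> \<K>'"
        using L(1) by simp
    qed auto
    also have "\<dots> \<longleftrightarrow> K \<in> \<K>"
      using e1(2)[OF K(1)] diameter_le_if_subset_ball[OF K(3) d(1)] d(4) by simp
    finally show ?thesis .
  qed
  then show "is_diff_germ g \<and> small_members \<K> \<and>
    (\<exists>d>0. \<forall>K. compact K \<and> 0 \<in> K \<and> K \<subseteq> ball 0 d \<longrightarrow> (g ` K \<in> \<K> \<longleftrightarrow> K \<in> \<K>))"
    using g eq1 d(1) unfolding germ_equiv_def by blast
next
  assume "is_diff_germ g \<and> small_members \<K> \<and>
    (\<exists>d>0. \<forall>K. compact K \<and> 0 \<in> K \<and> K \<subseteq> ball 0 d \<longrightarrow> (g ` K \<in> \<K> \<longleftrightarrow> K \<in> \<K>))"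
  then obtain d where g: "is_diff_germ g" and small: "small_members \<K>" and d: "d > 0"
    "\<And>K. compact K \<Longrightarrow> 0 \<in> K \<Longrightarrow> K \<subseteq> ball 0 d \<Longrightarrow> g ` K \<in> \<K> \<longleftrightarrow> K \<in> \<K>"
    by blast
  obtain r0 where "diff_rep g r0"
    using g by (auto simp: is_diff_germ_def)
  define r where "r = min r0 d"
  have r: "diff_rep g r" "r > 0" "r \<le> d"
    using diff_rep_mono[OF \<open>diff_rep g r0\<close>, of r] \<open>diff_rep g r0\<close> d(1)
    by (auto simp: r_def diff_rep_def)
  then have hol: "g holomorphic_on ball 0 r" and inj: "inj_on g (ball 0 r)" and g0: "g 0 = 0"
    by (auto simp: diff_rep_def)
  \<comment> \<open>Restricting to one disc, inside both the injectivity disc of g and the range of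
    the hypothesis, loses no member of small diameter.\<close>
  define \<K>' where "\<K>' = {K \<in> \<K>. K \<subseteq> ball 0 r}"
  have inK': "K \<in> \<K>' \<longleftrightarrow> K \<in> \<K>" if "diameter K < r" for K
    using that subset_ball_if_diameter_less KK by (auto simp: \<K>'_def)
  have small': "small_members \<K>'"
    unfolding small_members_def
  proof (intro allI impI)
    fix e :: real assume "e > 0"
    then obtain K where "K \<in> \<K>" "diameter K < min e r"
      using small r(2) unfolding small_members_def by (metis min_less_iff_conj)
    then show "\<exists>K\<in>\<K>'. diameter K < e"
      using inK'[of K] by auto
  qed
  have "germ_equiv \<K>' \<K>"
    using small small' inK' r(2) unfolding germ_equiv_def by blast
  moreover have "small_members ((\<lambda>K. g ` K) ` \<K>')"
    unfolding small_members_def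
  proof (intro allI impI)
    fix e :: real assume "e > 0"
    then have "e / 3 > 0"
      by simp
    obtain d1 where d1: "d1 > 0" "\<And>K. K \<subseteq> ball 0 d1 \<Longrightarrow> g ` K \<subseteq> ball 0 (e / 3)"
      by (rule germ_image_small[OF g \<open>e / 3 > 0\<close>]) blast
    obtain K where K: "K \<in> \<K>'" "diameter K < d1"
      using small' d1(1) by (auto simp: small_members_def)
    then have "K \<subseteq> ball 0 d1"
      using subset_ball_if_diameter_less KK by (auto simp: \<K>'_def)
    from diameter_le_if_subset_ball[OF d1(2)[OF this] \<open>e / 3 > 0\<close>]
    have "diameter (g ` K) < e"
      using \<open>e > 0\<close> by simp
    then show "\<exists>K\<in>(\<lambda>K. g ` K) ` \<K>'. diameter K < e"
      using K(1) by blast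
  qed
  moreover have "\<exists>e>0. \<forall>L. compact L \<and> diameter L < e \<longrightarrow> (L \<in> (\<lambda>K. g ` K) ` \<K>' \<longleftrightarrow> L \<in> \<K>)"
  proof -
    \<comment> \<open>The image of the disc contains a disc of radius e, so a member L of diameter
      below e is g(K) for K = h(L). The hypothesis, read from g(K) back to K, then puts K into
      \<K>.\<close>
    have "open (g ` ball 0 r)"
      by (rule open_mapping_thm3[OF hol _ inj]) simp
    moreover have "0 \<in> g ` ball 0 r"
      using g0 r(2) by force
    ultimately obtain e where e: "e > 0" "ball 0 e \<subseteq> g ` ball 0 r"
      by (meson open_contains_ball)
    obtain h where h: "h holomorphic_on g ` ball 0 r" "\<And>z. z \<in> ball 0 r \<Longrightarrow> h (g z) = z"
      using holomorphic_has_inverse[OF hol open_ball inj] by metis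
    have "L \<in> (\<lambda>K. g ` K) ` \<K>' \<longleftrightarrow> L \<in> \<K>" if L: "diameter L < e" for L
    proof
      assume "L \<in> (\<lambda>K. g ` K) ` \<K>'"
      then obtain K where K: "K \<in> \<K>" "K \<subseteq> ball 0 r" "L = g ` K"
        by (auto simp: \<K>'_def)
      then show "L \<in> \<K>"
        using d(2)[of K] KK[OF K(1)] r(3) subset_ball by (meson order_trans)
    next
      assume "L \<in> \<K>"
      then have cL: "compact L" "0 \<in> L" and "L \<subseteq> ball 0 e"
        using KK subset_ball_if_diameter_less L by blast+
      then have Lsub: "L \<subseteq> g ` ball 0 r"
        using e(2) by blast
      define K where "K = h ` L"
      have gK: "g ` K = L"
      proof -
        have "g (h w) = w" if "w \<in> L" for w
          using that Lsub h(2) by force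
        then show ?thesis
          by (force simp: K_def)
      qed
      have Kr: "K \<subseteq> ball 0 r"
        using Lsub h(2) by (force simp: K_def)
      have "compact K"
        unfolding K_def using cL(1) Lsub
        by (intro compact_continuous_image continuous_on_subset[OF holomorphic_on_imp_continuous_on[OF h(1)]])
      moreover have "0 \<in> K"
        using cL(2) h(2)[of 0] g0 r(2) by (force simp: K_def)
      ultimately have "K \<in> \<K>"
        using d(2)[of K] Kr r(3) gK \<open>L \<in> \<K>\<close> subset_ball by (metis order_trans)
      then show "L \<in> (\<lambda>K. g ` K) ` \<K>'"
        using Kr gK by (auto simp: \<K>'_def)
    qed
    then show ?thesis
      using e(1) by blast
  qed
  ultimately have "germ_equiv ((\<lambda>K. g ` K) ` \<K>') \<K>"
    using small unfolding germ_equiv_def by blast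
  then show "g \<in> Aut \<K>"
    using r(1) \<open>germ_equiv \<K>' \<K>\<close> unfolding Aut_def \<K>'_def by blast
qed

lemma Aut_comp:
  assumes KK: "\<And>K. K \<in> \<K> \<Longrightarrow> compact K \<and> 0 \<in> K" and g: "g \<in> Aut \<K>" and h: "h \<in> Aut \<K>"
  shows "g \<circ> h \<in> Aut \<K>"
proof -
  have germs: "is_diff_germ g" "is_diff_germ h" and small: "small_members \<K>"
    using g h by (auto simp: Aut_iff[OF KK])
  obtain d1 where d1: "d1 > 0"
    "\<And>K. compact K \<Longrightarrow> 0 \<in> K \<Longrightarrow> K \<subseteq> ball 0 d1 \<Longrightarrow> g ` K \<in> \<K> \<longleftrightarrow> K \<in> \<K>"
    using g by (auto simp: Aut_iff[OF KK])
  obtain d2 where d2: "d2 > 0"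
    "\<And>K. compact K \<Longrightarrow> 0 \<in> K \<Longrightarrow> K \<subseteq> ball 0 d2 \<Longrightarrow> h ` K \<in> \<K> \<longleftrightarrow> K \<in> \<K>"
    using h by (auto simp: Aut_iff[OF KK])
  obtain d3 where d3: "d3 > 0" "\<And>K. K \<subseteq> ball 0 d3 \<Longrightarrow> h ` K \<subseteq> ball 0 d1"
    "\<And>K. compact K \<Longrightarrow> K \<subseteq> ball 0 d3 \<Longrightarrow> compact (h ` K)"
    using germ_image_small[OF germs(2) d1(1)] by blast
  have "h 0 = 0"
    using germs(2) by (simp add: is_diff_germ_iff)
  have main: "\<forall>K. compact K \<and> 0 \<in> K \<and> K \<subseteq> ball 0 (min d2 d3) \<longrightarrow> ((g \<circ> h) ` K \<in> \<K> \<longleftrightarrow> K \<in> \<K>)"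
  proof (intro allI impI, elim conjE)
    fix K :: "complex set"
    assume K: "compact K" "0 \<in> K" "K \<subseteq> ball 0 (min d2 d3)"
    have sub: "K \<subseteq> ball 0 d2" "K \<subseteq> ball 0 d3"
      using K(3) by auto
    have "0 \<in> h ` K"
      using K(2) \<open>h 0 = 0\<close> by force
    then show "(g \<circ> h) ` K \<in> \<K> \<longleftrightarrow> K \<in> \<K>"
      using d1(2)[OF d3(3)[OF K(1) sub(2)] _ d3(2)[OF sub(2)]] d2(2)[OF K(1,2) sub(1)]
      by (simp add: image_comp)
  qed
  have pos: "min d2 d3 > 0"
    using d2(1) d3(1) by simp
  show ?thesis
    by (rule Aut_iff[THEN iffD2], erule KK)
      (intro conjI exI[of _ "min d2 d3"], rule germ_comp[OF germs], rule small, rule pos, rule main)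
qed

text \<open>For small K the criterion for g is read at the set h(K), whose image under g is
  K.\<close>

lemma Aut_inverse:
  assumes KK: "\<And>K. K \<in> \<K> \<Longrightarrow> compact K \<and> 0 \<in> K" and g: "g \<in> Aut \<K>"
  obtains h where "h \<in> Aut \<K>" "deriv h 0 = inverse (deriv g 0)"
    "\<forall>\<^sub>F z in nhds 0. h (g z) = z" "\<forall>\<^sub>F z in nhds 0. g (h z) = z"
proof -
  have germ: "is_diff_germ g" and small: "small_members \<K>"
    using g by (auto simp: Aut_iff[OF KK])
  obtain d1 where d1: "d1 > 0"
    "\<And>K. compact K \<Longrightarrow> 0 \<in> K \<Longrightarrow> K \<subseteq> ball 0 d1 \<Longrightarrow> g ` K \<in> \<K> \<longleftrightarrow> K \<in> \<K>"
    using g by (auto simp: Aut_iff[OF KK])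
  obtain h where h: "is_diff_germ h" "deriv h 0 = inverse (deriv g 0)"
    "\<forall>\<^sub>F z in nhds 0. h (g z) = z" "\<forall>\<^sub>F z in nhds 0. g (h z) = z"
    using germ_inverse[OF germ] by blast
  obtain d2 where d2: "d2 > 0" "\<And>z. z \<in> ball 0 d2 \<Longrightarrow> g (h z) = z"
    using h(4) by (rule eventually_nhds_0_subset) blast
  obtain d3 where d3: "d3 > 0" "\<And>K. K \<subseteq> ball 0 d3 \<Longrightarrow> h ` K \<subseteq> ball 0 d1"
    "\<And>K. compact K \<Longrightarrow> K \<subseteq> ball 0 d3 \<Longrightarrow> compact (h ` K)"
    using germ_image_small[OF h(1) d1(1)] by blast
  have "h 0 = 0"
    using h(1) by (simp add: is_diff_germ_iff)
  have main: "\<forall>K. compact K \<and> 0 \<in> K \<and> K \<subseteq> ball 0 (min d2 d3) \<longrightarrow> (h ` K \<in> \<K> \<longleftrightarrow> K \<in> \<K>)"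
  proof (intro allI impI, elim conjE)
    fix K :: "complex set"
    assume K: "compact K" "0 \<in> K" "K \<subseteq> ball 0 (min d2 d3)"
    have sub: "K \<subseteq> ball 0 d2" "K \<subseteq> ball 0 d3"
      using K(3) by auto
    have "0 \<in> h ` K"
      using K(2) \<open>h 0 = 0\<close> by force
    moreover have "g ` h ` K = K"
      using sub(1) d2(2) by (force simp: image_comp)
    ultimately show "h ` K \<in> \<K> \<longleftrightarrow> K \<in> \<K>"
      using d1(2)[OF d3(3)[OF K(1) sub(2)] _ d3(2)[OF sub(2)]] by simp
  qed
  have pos: "min d2 d3 > 0"
    using d2(1) d3(1) by simp
  have "h \<in> Aut \<K>"
    by (rule Aut_iff[THEN iffD2], erule KK)
      (intro conjI exI[of _ "min d2 d3"], rule h(1), rule small, rule pos, rule main)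
  then show ?thesis
    using that h by blast
qed

section \<open>Commutation with f and injectivity of the multiplier\<close>

lemma irrational_rotation_not_root_of_unity:
  assumes "\<alpha> \<notin> \<rat>" "n > 0"
  shows "exp (2 * pi * \<i> * complex_of_real \<alpha>) ^ n \<noteq> 1"
proof
  assume "exp (2 * pi * \<i> * complex_of_real \<alpha>) ^ n = 1"
  then have "exp (of_nat n * (2 * pi * \<i> * complex_of_real \<alpha>)) = 1"
    by (simp add: exp_of_nat_mult)
  then obtain m :: int where "of_nat n * (2 * pi * \<alpha>) = of_int (2 * m) * pi"
    by (auto simp: exp_eq_1)
  then have "\<alpha> = of_int m / of_nat n"
    using assms(2) by (simp add: field_simps)
  then show False
    using assms(1) by (simp add: Rats_divide)
qed

lemma siegel_compacta_props:
  "K \<in> siegel_compacta f \<Longrightarrow> compact K \<and> 0 \<in> K"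
  by (simp add: siegel_compacta_def siegel_compact_def)

lemma Aut_siegel_compacta_commutes:
  assumes f: "is_diff_germ f" and lam: "norm (deriv f 0) = 1" "\<And>n. n > 0 \<Longrightarrow> deriv f 0 ^ n \<noteq> 1"
    and g: "g \<in> Aut (siegel_compacta f)"
  shows "same_germ (f \<circ> g) (g \<circ> f)"
proof -
  have germ: "is_diff_germ g" and small: "small_members (siegel_compacta f)"
    using g by (auto simp: Aut_iff[OF siegel_compacta_props])
  obtain d1 where d1: "d1 > 0"
    "\<And>K. compact K \<Longrightarrow> 0 \<in> K \<Longrightarrow> K \<subseteq> ball 0 d1 \<Longrightarrow> g ` K \<in> siegel_compacta f \<longleftrightarrow> K \<in> siegel_compacta f"
    using g by (auto simp: Aut_iff[OF siegel_compacta_props])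
  obtain r where r: "diff_rep f r"
    using f by (auto simp: is_diff_germ_def)
  then have "r > 0"
    by (simp add: diff_rep_def)
  obtain d2 where d2: "d2 > 0" "\<And>K. K \<subseteq> ball 0 d2 \<Longrightarrow> g ` K \<subseteq> ball 0 r"
    by (rule germ_image_small[OF germ \<open>r > 0\<close>]) blast
  have P: "is_diff_germ (f \<circ> g)" and Q: "is_diff_germ (g \<circ> f)"
    using f germ by (auto intro: germ_comp)
  \<comment> \<open>The commutator is a local inverse of g \<circ> f applied after f \<circ> g. The
    left inverse property shows that it preserves K; the right one turns its triviality into
    commutation.\<close>
  obtain E where E: "is_diff_germ E" "deriv E 0 = inverse (deriv (g \<circ> f) 0)"
    "\<forall>\<^sub>F z in nhds 0. E ((g \<circ> f) z) = z" "\<forall>\<^sub>F z in nhds 0. (g \<circ> f) (E z) = z"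
    using germ_inverse[OF Q] by blast
  obtain d3 where d3: "d3 > 0" "\<And>z. z \<in> ball 0 d3 \<Longrightarrow> E ((g \<circ> f) z) = z"
    using E(3) by (rule eventually_nhds_0_subset) blast
  have "same_germ (E \<circ> (f \<circ> g)) id"
  proof (rule tangent_to_id_rigid[OF f lam])
    show "is_diff_germ (E \<circ> (f \<circ> g))"
      by (rule germ_comp[OF E(1) P])
    have "deriv g 0 \<noteq> 0" "deriv f 0 \<noteq> 0"
      using f germ by (auto simp: is_diff_germ_iff)
    then show "deriv (E \<circ> (f \<circ> g)) 0 = 1"
      using germ_deriv_comp[OF E(1) P] germ_deriv_comp[OF f germ] germ_deriv_comp[OF germ f] E(2)
      by (simp add: field_simps)
    fix d :: real assume "d > 0"
    \<comment> \<open>The five radii ensure in turn: the requested size of K, the domain of f,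
      invariance of membership under g, that g(K) stays in the domain of f, and that
      \<open>E\<close> inverts g \<circ> f on K.\<close>
    define e where "e = Min {d, r, d1, d2, d3}"
    have e: "e > 0" "e \<le> d" "e \<le> r" "e \<le> d1" "e \<le> d2" "e \<le> d3"
      using \<open>d > 0\<close> \<open>r > 0\<close> d1(1) d2(1) d3(1) by (auto simp: e_def)
    obtain K where K: "K \<in> siegel_compacta f" "diameter K < e"
      using small e(1) by (auto simp: small_members_def)
    have K': "compact K" "0 \<in> K" "K \<noteq> {0}"
      using K(1) by (auto simp: siegel_compacta_def siegel_compact_def)
    have "K \<subseteq> ball 0 e"
      using subset_ball_if_diameter_less K' K(2) by blast
    then have sub: "K \<subseteq> ball 0 d" "K \<subseteq> ball 0 r" "K \<subseteq> ball 0 d1" "K \<subseteq> ball 0 d2" "K \<subseteq> ball 0 d3"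
      using e subset_ball[of e _ "0::complex"] by (meson order_trans)+
    have fK: "f ` K = K"
      using siegel_compact_image[OF r _ sub(2)] K(1) by (simp add: siegel_compacta_def)
    have "g ` K \<in> siegel_compacta f"
      using d1(2)[OF K'(1,2) sub(3)] K(1) by blast
    then have "f ` g ` K = g ` K"
      using siegel_compact_image[OF r _ d2(2)[OF sub(4)]] by (simp add: siegel_compacta_def)
    then have "(E \<circ> (f \<circ> g)) ` K = E ` g ` K"
      by (simp only: image_comp[symmetric])
    also have "\<dots> = E ` g ` f ` K"
      by (simp only: fK)
    also have "\<dots> = (\<lambda>z. E ((g \<circ> f) z)) ` K"
      by (simp add: image_comp o_def)
    also have "\<dots> = (\<lambda>z. z) ` K"
      using d3(2) sub(5) by (intro image_cong) auto
    finally have "(E \<circ> (f \<circ> g)) ` K = K"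
      by simp
    then show "\<exists>K. compact K \<and> 0 \<in> K \<and> K \<noteq> {0} \<and> K \<subseteq> ball 0 d \<and> f ` K = K \<and> (E \<circ> (f \<circ> g)) ` K = K"
      using K' sub(1) fK by blast
  qed
  then have "\<forall>\<^sub>F z in nhds 0. E ((f \<circ> g) z) = z"
    by (simp add: same_germ_iff_eventually)
  with eventually_germ[OF P E(4)] have "\<forall>\<^sub>F z in nhds 0. (f \<circ> g) z = (g \<circ> f) z"
    by eventually_elim simp
  then show ?thesis
    by (simp only: same_germ_iff_eventually)
qed

lemma centralizer_tangent_to_id_trivial:
  assumes f: "is_diff_germ f" and lam: "\<And>n. n > 0 \<Longrightarrow> deriv f 0 ^ n \<noteq> 1"
    and k: "is_diff_germ k" "deriv k 0 = 1" and comm: "same_germ (f \<circ> k) (k \<circ> f)"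
  shows "same_germ k id"
proof (rule ccontr)
  assume "\<not> same_germ k id"
  then obtain n a where n: "n > 0" "a \<noteq> 0" "((\<lambda>z. (k z - z) / z ^ Suc n) \<longlongrightarrow> a) (at 0)"
    using tangent_to_id_leading_term k by metis
  obtain E where E: "is_diff_germ E" "\<forall>\<^sub>F z in nhds 0. E (f z) = z"
    using germ_inverse[OF f] by blast
  have "\<forall>\<^sub>F z in nhds 0. f (k z) = k (f z)"
    using comm by (simp add: same_germ_iff_eventually)
  with eventually_germ[OF k(1) E(2)] have "\<forall>\<^sub>F z in nhds 0. E (k (f z)) = k z"
    by eventually_elim metis
  then have "\<forall>\<^sub>F z in at 0. (E (k (f z)) - z) / z ^ Suc n = (k z - z) / z ^ Suc n"
    unfolding eventually_at_filter by eventually_elim simp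
  with conj_leading_term[OF f E k(1) n(3,2)]
  have "((\<lambda>z. (k z - z) / z ^ Suc n) \<longlongrightarrow> a * deriv f 0 ^ n) (at 0)"
    by (rule Lim_transform_eventually)
  with n(3) have "a = a * deriv f 0 ^ n"
    by (rule tendsto_unique[OF at_neq_bot])
  then show False
    using n(1,2) lam by simp
qed

theorem theorem3p9:
  fixes f :: "complex \<Rightarrow> complex" and \<alpha> :: real
  assumes "is_diff_germ f"
    and "\<alpha> \<notin> \<rat>"
    and "deriv f 0 = exp (2 * pi * \<i> * complex_of_real \<alpha>)"
    and "\<not> linearizable f \<alpha>"
  defines "A \<equiv> Aut (siegel_compacta f)"
  shows "(\<forall>g\<in>A. \<forall>h\<in>A. g \<circ> h \<in> A \<and> deriv (g \<circ> h) 0 = deriv g 0 * deriv h 0)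
       \<and> (\<forall>g\<in>A. \<exists>h\<in>A. same_germ (h \<circ> g) id \<and> same_germ (g \<circ> h) id)
       \<and> (\<forall>g\<in>A. deriv g 0 \<noteq> 0 \<and> norm (deriv g 0) = 1)
       \<and> (\<forall>g\<in>A. \<forall>h\<in>A. deriv g 0 = deriv h 0 \<longrightarrow> same_germ g h)
       \<and> (\<forall>g\<in>A. \<forall>h\<in>A. same_germ (g \<circ> h) (h \<circ> g))
       \<and> (\<forall>g\<in>A. \<forall>h\<in>A. \<forall>\<theta>1 \<theta>2::real.
            deriv g 0 = exp (2 * pi * \<i> * complex_of_real \<theta>1) \<and>
            deriv h 0 = exp (2 * pi * \<i> * complex_of_real \<theta>2) \<and> \<theta>1 - \<theta>2 \<in> \<int>
            \<longrightarrow> same_germ g h)"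
proof -
  have lam: "norm (deriv f 0) = 1" "\<And>n. n > 0 \<Longrightarrow> deriv f 0 ^ n \<noteq> 1"
    unfolding assms(3) using irrational_rotation_not_root_of_unity[OF assms(2)] by (auto simp: norm_exp_eq_Re)
  have germ: "is_diff_germ g" if "g \<in> A" for g
    using that unfolding A_def by (simp add: Aut_iff[OF siegel_compacta_props])
  have comp: "g \<circ> h \<in> A" "deriv (g \<circ> h) 0 = deriv g 0 * deriv h 0" if "g \<in> A" "h \<in> A" for g h
    using Aut_comp[OF siegel_compacta_props] germ_deriv_comp germ that unfolding A_def by auto
  have inv: "\<exists>h\<in>A. deriv h 0 = inverse (deriv g 0) \<and> (\<forall>\<^sub>F z in nhds 0. h (g z) = z) \<and> (\<forall>\<^sub>F z in nhds 0. g (h z) = z)"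
    if "g \<in> A" for g
    by (rule Aut_inverse[OF siegel_compacta_props that[unfolded A_def]]) (auto simp: A_def)
  have comm: "same_germ (f \<circ> g) (g \<circ> f)" if "g \<in> A" for g
    using Aut_siegel_compacta_commutes[OF assms(1) lam] that unfolding A_def by blast
  have nz: "deriv g 0 \<noteq> 0" if "g \<in> A" for g
    using germ[OF that] by (simp add: is_diff_germ_iff)
  \<comment> \<open>Nonlinearizability excludes contractions; expansions are then excluded by
    applying this bound to the inverse, which again lies in \<open>A\<close>.\<close>
  have ge1: "norm (deriv g 0) \<ge> 1" if "g \<in> A" for g
  proof (rule ccontr)
    assume "\<not> norm (deriv g 0) \<ge> 1"
    moreover have "\<forall>\<^sub>F z in nhds 0. f (g z) = g (f z)"
      using comm[OF that] by (simp add: same_germ_iff_eventually)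
    ultimately show False
      using linearizable_if_commutes_with_contraction[OF assms(1,3) germ[OF that]] assms(4) by simp
  qed
  have norm1: "norm (deriv g 0) = 1" if g: "g \<in> A" for g
  proof -
    obtain h where "h \<in> A" "deriv h 0 = inverse (deriv g 0)"
      using inv[OF g] by blast
    then have "1 \<le> inverse (norm (deriv g 0))"
      using ge1[of h] by (simp add: norm_inverse)
    then have "norm (deriv g 0) \<le> 1"
      using nz[OF g] by (simp add: field_simps)
    with ge1[OF g] show ?thesis
      by simp
  qed
  have unique: "same_germ g h" if g: "g \<in> A" and h: "h \<in> A" and eq: "deriv g 0 = deriv h 0" for g h
  proof -
    obtain h' where h': "h' \<in> A" "deriv h' 0 = inverse (deriv h 0)" "\<forall>\<^sub>F z in nhds 0. h (h' z) = z"
      using inv[OF h] by blast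
    \<comment> \<open>Injectivity is reduced to the kernel: h' \<circ> g lies in \<open>A\<close>,
      hence commutes with f, and its multiplier is 1.\<close>
    have "same_germ (h' \<circ> g) id"
      using comp[OF h'(1) g] nz[OF h] h'(2) eq
      by (intro centralizer_tangent_to_id_trivial[OF assms(1) lam(2)] germ comm) auto
    then have "\<forall>\<^sub>F z in nhds 0. h' (g z) = z"
      by (simp add: same_germ_iff_eventually)
    with eventually_germ[OF germ[OF g] h'(3)] have "\<forall>\<^sub>F z in nhds 0. g z = h z"
      by eventually_elim simp
    then show ?thesis
      by (simp only: same_germ_iff_eventually)
  qed
  have angle: "same_germ g h"
    if gh: "g \<in> A" "h \<in> A" "deriv g 0 = exp (2 * pi * \<i> * complex_of_real \<theta>1)"
      "deriv h 0 = exp (2 * pi * \<i> * complex_of_real \<theta>2)" "\<theta>1 - \<theta>2 \<in> \<int>" for g h and \<theta>1 \<theta>2 :: real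
  proof -
    obtain m :: int where "\<theta>1 = \<theta>2 + of_int m"
      using gh(5) by (auto elim!: Ints_cases simp: algebra_simps)
    then have "2 * pi * \<i> * complex_of_real \<theta>1 = 2 * pi * \<i> * complex_of_real \<theta>2 + (of_int (2 * m) * pi) * \<i>"
      by (simp add: algebra_simps)
    then have "deriv g 0 = deriv h 0"
      unfolding gh(3,4) exp_eq by blast
    then show ?thesis
      using unique gh(1,2) by blast
  qed
  \<comment> \<open>Both products lie in \<open>A\<close> and have the same multiplier, so
    injectivity identifies them.\<close>
  have commute: "same_germ (g \<circ> h) (h \<circ> g)" if "g \<in> A" "h \<in> A" for g h
    using that comp by (intro unique) (auto simp: mult.commute)
  have inverse: "\<exists>h\<in>A. same_germ (h \<circ> g) id \<and> same_germ (g \<circ> h) id" if "g \<in> A" for g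
    using inv[OF that] by (simp add: same_germ_iff_eventually) blast
  show ?thesis
    by (intro conjI ballI allI impI; (elim conjE)?;
      (rule comp inverse nz norm1 commute angle unique; assumption))
qed

end
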